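(* Let $S$ be a set of $2n$ points in general position in the plane, where $n = 2^k + h$ with $0 \leq h < 2^k$. Then there exist at least $k$ edge-disjoint non-crossing perfect matchings $F_1, F_2, \ldots, F_k$ on $S$ such that $\bigcup_{i=1}^k F_i$ is a triangle-free geometric graph.
   Context: Points are in general position if no three lie on a common line. Here $k$ and $h$ are nonnegative integers. A geometric graph is a graph whose vertices are points in general position in the plane and whose edges are straight-line segments joining vertices. Two edges cross if they have a common point that is interior to both of them. A perfect matching on $S$ is a set of segments with endpoints in $S$ such that each point of $S$ is an endpoint of exactly one of them; it is non-crossing if no two of its edges cross. Matchings are edge-disjoint if no two of them have an edge in common. A geometric graph is triangle-free if it contains no complete subgraph on three vertices. *)

theory Defs
  imports "HOL-Analysis.Analysis"
begin

type_synonym point = "real^2"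

text \<open>
  A segment between distinct points \<open>a\<close> and \<open>b\<close> is determined by its endpoints
  and is represented by the two-element set \<open>{a, b}\<close>. The points interior to it are those of
  \<open>open_segment a b\<close>, so two edges that only share an endpoint need not cross.
\<close>

definition general_position :: "point set \<Rightarrow> bool" where
  "general_position S \<longleftrightarrow>
     (\<forall>a\<in>S. \<forall>b\<in>S. \<forall>c\<in>S. a \<noteq> b \<and> b \<noteq> c \<and> a \<noteq> c \<longrightarrow> \<not> collinear {a, b, c})"

definition segments_on :: "point set \<Rightarrow> point set set" where
  "segments_on S = {{a, b} | a b. a \<in> S \<and> b \<in> S \<and> a \<noteq> b}"

definition geometric_graph :: "point set \<Rightarrow> point set set \<Rightarrow> bool" where
  "geometric_graph V E \<longleftrightarrow> general_position V \<and> E \<subseteq> segments_on V"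

definition crosses :: "point set \<Rightarrow> point set \<Rightarrow> bool" where
  "crosses e f \<longleftrightarrow>
     (\<exists>a b c d. e = {a, b} \<and> f = {c, d} \<and> open_segment a b \<inter> open_segment c d \<noteq> {})"

definition perfect_matching :: "point set \<Rightarrow> point set set \<Rightarrow> bool" where
  "perfect_matching S F \<longleftrightarrow> F \<subseteq> segments_on S \<and> (\<forall>p\<in>S. \<exists>!e. e \<in> F \<and> p \<in> e)"

definition non_crossing :: "point set set \<Rightarrow> bool" where
  "non_crossing F \<longleftrightarrow> pairwise (\<lambda>e f. \<not> crosses e f) F"

definition triangle_free :: "point set \<Rightarrow> point set set \<Rightarrow> bool" where
  "triangle_free V E \<longleftrightarrow>
     \<not> (\<exists>a\<in>V. \<exists>b\<in>V. \<exists>c\<in>V. a \<noteq> b \<and> b \<noteq> c \<and> a \<noteq> c \<and>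
          {a, b} \<in> E \<and> {b, c} \<in> E \<and> {a, c} \<in> E)"

end

theory Submission
  imports Defs
begin

text \<open>
  Cut the points by a line into two even parts \<open>L\<close> and \<open>R\<close>, of sizes as equal as possible, and
  pack matchings into both by induction. Since \<open>L\<close> and \<open>R\<close> have disjoint convex hulls, a
  matching of \<open>L\<close> together with one of \<open>R\<close> is a non-crossing matching of the whole set. One
  further matching joins \<open>L\<close> to \<open>R\<close>: a shortest one among those does not cross itself, because
  exchanging the partners along two crossing edges makes it shorter
  (\<open>non_crossing_bij_exists\<close>). It shares no edge with the matchings inside the parts. A triangle
  that meets both parts would have two of its edges between \<open>L\<close> and \<open>R\<close> at a common vertex, and
  edges of a single matching never share one; so all triangles lie inside a part
  (\<open>triangle_free_Un_matching\<close>). Each halving costs one matching, which gives \<open>k\<close> of them as soon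
  as \<open>n \<ge> 2 ^ k\<close>.

  The difficulty is an odd \<open>n\<close>: then \<open>R\<close> has two more points than \<open>L\<close>, and the new matching needs
  one edge inside \<open>R\<close>. This edge must be new, must not close a triangle with the edges
  packed into \<open>R\<close>, and must not cross the edges from \<open>L\<close> to \<open>R\<close>. The induction therefore
  reserves such an edge: for any direction \<open>u\<close> that separates the points of the set, the two lowest
  points in direction \<open>u\<close> form a segment that is not used and closes no triangle
  (\<open>matching_packing\<close>). In \<open>R\<close> the hypothesis is used upside down, with \<open>- u\<close>, so that the two
  highest points of \<open>R\<close> are reserved. A line separates them from all other points, so the segment
  between them crosses no other edge. In \<open>L\<close> it is used with \<open>u\<close> itself, and the segment
  reserved there is the one reserved for the whole set.
\<close>

section \<open>Perfect matchings\<close>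

lemma segments_on_mono: "A \<subseteq> B \<Longrightarrow> segments_on A \<subseteq> segments_on B"
  unfolding segments_on_def by blast

lemma segments_on_subset: "e \<in> segments_on A \<Longrightarrow> e \<subseteq> A"
  unfolding segments_on_def by blast

lemma segments_on_disjoint:
  assumes "A \<inter> B = {}" "e \<in> segments_on A"
  shows "e \<notin> segments_on B"
proof
  assume "e \<in> segments_on B"
  then have "e \<subseteq> {}" using assms segments_on_subset by blast
  moreover have "e \<noteq> {}" using assms(2) unfolding segments_on_def by blast
  ultimately show False by blast
qed

lemma card_2_segment:
  assumes "card D = 2" "D \<subseteq> A"
  shows "D \<in> segments_on A"
proof -
  obtain x y where "D = {x, y}" "x \<noteq> y" using assms(1) by (meson card_2_iff)
  then show ?thesis using assms(2) unfolding segments_on_def by blast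
qed

lemma perfect_matching_segments:
  assumes "perfect_matching S F" "e \<in> F"
  shows "e \<in> segments_on S"
proof -
  have "F \<subseteq> segments_on S" using assms(1) unfolding perfect_matching_def by (rule conjunct1)
  then show ?thesis using assms(2) by (rule subsetD)
qed

lemma perfect_matching_Un:
  assumes F: "perfect_matching A F" and G: "perfect_matching B G" and disj: "A \<inter> B = {}"
  shows "perfect_matching (A \<union> B) (F \<union> G)"
  unfolding perfect_matching_def
proof (intro conjI ballI)
  have FA: "\<And>e. e \<in> F \<Longrightarrow> e \<subseteq> A" and GB: "\<And>e. e \<in> G \<Longrightarrow> e \<subseteq> B"
    using F G segments_on_subset unfolding perfect_matching_def by blast+
  show "F \<union> G \<subseteq> segments_on (A \<union> B)"
    using F G segments_on_mono[of A "A \<union> B"] segments_on_mono[of B "A \<union> B"]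
    unfolding perfect_matching_def by blast
  fix p assume "p \<in> A \<union> B"
  then show "\<exists>!e. e \<in> F \<union> G \<and> p \<in> e"
  proof
    assume p: "p \<in> A"
    then have "\<exists>!e. e \<in> F \<and> p \<in> e" using F unfolding perfect_matching_def by blast
    moreover have "e \<notin> G" if "p \<in> e" for e using that GB p disj by blast
    ultimately show ?thesis by blast
  next
    assume p: "p \<in> B"
    then have "\<exists>!e. e \<in> G \<and> p \<in> e" using G unfolding perfect_matching_def by blast
    moreover have "e \<notin> F" if "p \<in> e" for e using that FA p disj by blast
    ultimately show ?thesis by blast
  qed
qed

lemma perfect_matching_single:
  assumes "card D = 2"
  shows "perfect_matching D {D}"
  using card_2_segment[OF assms] unfolding perfect_matching_def by blast

lemma perfect_matching_bij:
  assumes f: "bij_betw f A B" and disj: "A \<inter> B = {}"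
  shows "perfect_matching (A \<union> B) ((\<lambda>x. {x, f x}) ` A)"
  unfolding perfect_matching_def
proof (intro conjI ballI)
  have fB: "\<And>x. x \<in> A \<Longrightarrow> f x \<in> B" using f bij_betwE by blast
  show "(\<lambda>x. {x, f x}) ` A \<subseteq> segments_on (A \<union> B)"
  proof (rule image_subsetI)
    fix x assume "x \<in> A"
    then have "x \<in> A \<union> B" "f x \<in> A \<union> B" "x \<noteq> f x" using fB[of x] disj by auto
    then show "{x, f x} \<in> segments_on (A \<union> B)" unfolding segments_on_def by blast
  qed
  fix p assume "p \<in> A \<union> B"
  then obtain x where x: "x \<in> A" "p = x \<or> p = f x"
    using f unfolding bij_betw_def by blast
  have unique: "y = x" if "y \<in> A" "p \<in> {y, f y}" for y
    using x that fB[OF x(1)] fB[OF that(1)] disj inj_onD[OF bij_betw_imp_inj_on[OF f] _ x(1) that(1)]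
    by auto
  show "\<exists>!e. e \<in> (\<lambda>x. {x, f x}) ` A \<and> p \<in> e"
  proof (rule ex1I)
    show "{x, f x} \<in> (\<lambda>x. {x, f x}) ` A \<and> p \<in> {x, f x}" using x by blast
  next
    fix e assume e: "e \<in> (\<lambda>x. {x, f x}) ` A \<and> p \<in> e"
    then obtain y where y: "y \<in> A" "e = {y, f y}" by blast
    then have "p \<in> {y, f y}" using e by simp
    then show "e = {x, f x}" using unique[OF y(1)] y(2) by simp
  qed
qed

section \<open>Crossings\<close>

lemma crosses_iff:
  "crosses {a, b} {c, d} \<longleftrightarrow> open_segment a b \<inter> open_segment c d \<noteq> {}"
proof
  assume "crosses {a, b} {c, d}"
  then obtain a' b' c' d' where eq: "{a, b} = {a', b'}" "{c, d} = {c', d'}"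
    and cr: "open_segment a' b' \<inter> open_segment c' d' \<noteq> {}"
    unfolding crosses_def by blast
  have "open_segment a' b' = open_segment a b" "open_segment c' d' = open_segment c d"
    using eq open_segment_commute unfolding doubleton_eq_iff by metis+
  with cr show "open_segment a b \<inter> open_segment c d \<noteq> {}" by simp
next
  assume "open_segment a b \<inter> open_segment c d \<noteq> {}"
  then show "crosses {a, b} {c, d}"
    unfolding crosses_def by (intro exI conjI) (rule refl)+
qed

lemma crosses_commute: "crosses e f \<longleftrightarrow> crosses f e"
  unfolding crosses_def by (metis Int_commute)

text \<open>
  With \<open>u\<close> regarded as pointing upwards, a line orthogonal to \<open>u\<close> separates the two sets if they are
  finite. Negating \<open>u\<close> turns the picture upside down.
\<close>

definition below :: "point \<Rightarrow> point set \<Rightarrow> point set \<Rightarrow> bool" where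
  "below u A B \<longleftrightarrow> (\<forall>a\<in>A. \<forall>b\<in>B. u \<bullet> a < u \<bullet> b)"

lemma below_disjoint: "below u A B \<Longrightarrow> A \<inter> B = {}"
  unfolding below_def by fastforce

lemma inner_open_segment_bounds:
  assumes "p \<in> open_segment a b"
  shows "min (u \<bullet> a) (u \<bullet> b) \<le> u \<bullet> p" "u \<bullet> p \<le> max (u \<bullet> a) (u \<bullet> b)"
proof -
  obtain t where t: "0 < t" "t < 1" "p = (1 - t) *\<^sub>R a + t *\<^sub>R b"
    using assms unfolding in_segment by blast
  then have p: "u \<bullet> p = (1 - t) * (u \<bullet> a) + t * (u \<bullet> b)"
    by (simp add: inner_add_right)
  have "(1 - t) * (u \<bullet> a) \<le> (1 - t) * max (u \<bullet> a) (u \<bullet> b)" "t * (u \<bullet> b) \<le> t * max (u \<bullet> a) (u \<bullet> b)"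
    "(1 - t) * min (u \<bullet> a) (u \<bullet> b) \<le> (1 - t) * (u \<bullet> a)" "t * min (u \<bullet> a) (u \<bullet> b) \<le> t * (u \<bullet> b)"
    using t by (auto intro!: mult_left_mono)
  then show "min (u \<bullet> a) (u \<bullet> b) \<le> u \<bullet> p" "u \<bullet> p \<le> max (u \<bullet> a) (u \<bullet> b)"
    unfolding p by (auto simp: algebra_simps)
qed

text \<open>
  The height of a point of an edge lies between the heights of its endpoints, so a common point of
  the two edges would be too low for the upper one or too high for the lower one.
\<close>

lemma below_not_crosses:
  assumes AB: "below u A B" and e: "e \<in> segments_on A" and f: "f \<in> segments_on B"
  shows "\<not> crosses e f"
proof
  assume cr: "crosses e f"
  obtain a a' b b' where ab: "e = {a, a'}" "f = {b, b'}" "a \<in> A" "a' \<in> A" "b \<in> B" "b' \<in> B"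
    using e f unfolding segments_on_def by blast
  then obtain p where "p \<in> open_segment a a'" "p \<in> open_segment b b'"
    using cr crosses_iff by auto
  then have "u \<bullet> p \<le> max (u \<bullet> a) (u \<bullet> a')" "min (u \<bullet> b) (u \<bullet> b') \<le> u \<bullet> p"
    using inner_open_segment_bounds by blast+
  moreover have "max (u \<bullet> a) (u \<bullet> a') < min (u \<bullet> b) (u \<bullet> b')"
    using AB ab unfolding below_def by simp
  ultimately show False by linarith
qed

lemma non_crossing_Un:
  assumes "non_crossing F" "non_crossing G" "below u A B"
    and "F \<subseteq> segments_on A" "G \<subseteq> segments_on B"
  shows "non_crossing (F \<union> G)"
  unfolding non_crossing_def pairwise_def
proof (intro ballI impI)
  have FG: "\<not> crosses e f" if "e \<in> F" "f \<in> G" for e f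
    using below_not_crosses[OF assms(3)] assms(4,5) that by blast
  fix e f assume "e \<in> F \<union> G" "f \<in> F \<union> G" and ne: "e \<noteq> f"
  then consider "e \<in> F" "f \<in> F" | "e \<in> G" "f \<in> G" | "e \<in> F" "f \<in> G" | "e \<in> G" "f \<in> F"
    by blast
  then show "\<not> crosses e f"
  proof cases
    case 1 then show ?thesis using assms(1) ne unfolding non_crossing_def pairwise_def by blast
  next
    case 2 then show ?thesis using assms(2) ne unfolding non_crossing_def pairwise_def by blast
  next
    case 3 then show ?thesis by (rule FG)
  next
    case 4 then show ?thesis using FG crosses_commute by metis
  qed
qed

section \<open>A shortest matching does not cross itself\<close>

text \<open>
  The two diagonals \<open>ab\<close> and \<open>cd\<close> of a quadrilateral meet in a point \<open>p\<close>, and the triangle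
  inequality over \<open>p\<close> bounds the sides \<open>ad\<close> and \<open>cb\<close>. Equality for \<open>ad\<close> would put \<open>p\<close> on
  that side as well, and then \<open>a\<close>, \<open>b\<close>, \<open>d\<close> would be collinear.
\<close>

lemma crossing_exchange_shorter:
  fixes a b c d :: point
  assumes p: "p \<in> open_segment a b" "p \<in> open_segment c d"
    and nc: "\<not> collinear {a, b, d}"
  shows "dist a d + dist c b < dist a b + dist c d"
proof -
  have pab: "between (a, b) p" and pcd: "between (c, d) p" and pa: "p \<noteq> a"
    using p unfolding between_mem_segment open_segment_def by auto
  have "dist a b = dist a p + dist p b" "dist c d = dist c p + dist p d"
    using pab pcd between by blast+
  moreover have "dist c b \<le> dist c p + dist p b" by (rule dist_triangle)
  moreover have "dist a d < dist a p + dist p d"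
  proof (rule ccontr)
    assume "\<not> dist a d < dist a p + dist p d"
    then have "dist a d = dist a p + dist p d" using dist_triangle[of a d p] by linarith
    then have "between (a, d) p" using between by blast
    then have "collinear {a, p, d}" using between_imp_collinear by (simp add: insert_commute)
    moreover have "collinear {a, p, b}"
      using pab between_imp_collinear by (simp add: insert_commute)
    ultimately have "collinear {a, b, d}"
      using collinear_3_trans[of b a p d] pa by (simp add: insert_commute)
    with nc show False by contradiction
  qed
  ultimately show ?thesis by linarith
qed

text \<open>
  Among the finitely many bijections from \<open>A\<close> to \<open>B\<close>, one of least total length works: exchanging
  the partners of two points whose edges cross would again give a bijection, and a shorter one.
\<close>

lemma non_crossing_bij_exists:
  assumes fin: "finite A" "finite B" and card: "card A = card B" and disj: "A \<inter> B = {}"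
    and gp: "general_position (A \<union> B)"
  shows "\<exists>f. bij_betw f A B \<and> non_crossing ((\<lambda>x. {x, f x}) ` A)"
proof -
  define len where "len f = (\<Sum>x\<in>A. dist x (f x))" for f :: "point \<Rightarrow> point"
  \<comment> \<open>Restricting the functions to \<open>A\<close> makes the set of candidates finite.\<close>
  define Bij where "Bij = {f \<in> A \<rightarrow>\<^sub>E B. bij_betw f A B}"
  have "finite Bij"
    unfolding Bij_def using finite_PiE[OF fin(1), of "\<lambda>_. B"] fin(2) by simp
  moreover have "Bij \<noteq> {}"
  proof -
    obtain g where g: "bij_betw g A B" using finite_same_card_bij[OF fin card] by blast
    then have "bij_betw (restrict g A) A B" by (simp cong: bij_betw_cong)
    then have "restrict g A \<in> Bij"
      using g unfolding Bij_def by (auto dest: bij_betwE)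
    then show ?thesis by blast
  qed
  ultimately obtain f where f: "f \<in> Bij" and least: "\<And>g. g \<in> Bij \<Longrightarrow> len f \<le> len g"
    using that arg_min_if_finite(1)[of Bij len] arg_min_least[of Bij _ len] by metis
  have bij: "bij_betw f A B" using f unfolding Bij_def by blast
  have fB: "\<And>x. x \<in> A \<Longrightarrow> f x \<in> B" using bij bij_betwE by blast
  have "open_segment x (f x) \<inter> open_segment y (f y) = {}"
    if xy: "x \<in> A" "y \<in> A" "x \<noteq> y" for x y
  proof (rule ccontr)
    assume "open_segment x (f x) \<inter> open_segment y (f y) \<noteq> {}"
    then obtain p where p: "p \<in> open_segment x (f x)" "p \<in> open_segment y (f y)" by blast
    have "f x \<noteq> f y" using inj_onD[OF bij_betw_imp_inj_on[OF bij] _ xy(1,2)] xy(3) by blast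
    moreover have "x \<noteq> f x" "x \<noteq> f y" using xy(1) fB[OF xy(1)] fB[OF xy(2)] disj by auto
    moreover have "x \<in> A \<union> B" "f x \<in> A \<union> B" "f y \<in> A \<union> B"
      using xy(1) fB[OF xy(1)] fB[OF xy(2)] by auto
    ultimately have "\<not> collinear {x, f x, f y}"
      using gp unfolding general_position_def by metis
    then have shorter: "dist x (f y) + dist y (f x) < dist x (f x) + dist y (f y)"
      by (rule crossing_exchange_shorter[OF p])
    define g where "g = f(x := f y, y := f x)"
    have "bij_betw g A B"
      unfolding g_def using bij_betw_swap_iff[of x A y f B] bij xy
      by (simp add: Fun.swap_def)
    moreover have "g \<in> A \<rightarrow>\<^sub>E B"
      using f xy fB unfolding Bij_def g_def by (auto simp: PiE_def extensional_def)
    ultimately have "len f \<le> len g" using least unfolding Bij_def by blast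
    moreover have split: "len h = dist x (h x) + (dist y (h y) + (\<Sum>z\<in>A - {x} - {y}. dist z (h z)))" for h
      unfolding len_def using xy fin(1)
      by (subst sum.remove[of A x], simp, simp, subst sum.remove[of "A - {x}" y]) auto
    have "(\<Sum>z\<in>A - {x} - {y}. dist z (g z)) = (\<Sum>z\<in>A - {x} - {y}. dist z (f z))"
      by (rule sum.cong) (auto simp: g_def)
    then have "len g < len f"
      unfolding split using shorter xy by (simp add: g_def)
    ultimately show False by linarith
  qed
  then have "non_crossing ((\<lambda>x. {x, f x}) ` A)"
    unfolding non_crossing_def pairwise_def by (auto simp: crosses_iff)
  with bij show ?thesis by blast
qed

section \<open>Cutting a point set into two parts\<close>

text \<open>
  A direction is bad only if it is orthogonal to the difference of two of the points. These are
  finitely many hyperplanes, which do not cover the space because they are null sets.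
\<close>

lemma injective_direction_exists:
  fixes S :: "point set"
  assumes "finite S"
  shows "\<exists>u. inj_on (\<lambda>x. u \<bullet> x) S"
proof -
  define D where "D = {(x, y). x \<in> S \<and> y \<in> S \<and> x \<noteq> y}"
  have "D \<subseteq> S \<times> S" unfolding D_def by blast
  then have "finite D" using assms finite_subset by blast
  then have "negligible (\<Union>(x, y)\<in>D. {u. (x - y) \<bullet> u = 0})"
    by (intro negligible_Union) (auto simp: D_def intro!: negligible_hyperplane)
  then have "(\<Union>(x, y)\<in>D. {u. (x - y) \<bullet> u = 0}) \<noteq> UNIV"
    using non_negligible_UNIV by metis
  then obtain u where "u \<notin> (\<Union>(x, y)\<in>D. {u. (x - y) \<bullet> u = 0})" by blast
  then have "(x - y) \<bullet> u \<noteq> 0" if "x \<in> S" "y \<in> S" "x \<noteq> y" for x y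
    using that unfolding D_def by blast
  then have "u \<bullet> x \<noteq> u \<bullet> y" if "x \<in> S" "y \<in> S" "x \<noteq> y" for x y
    using that by (metis inner_commute inner_diff_left right_minus_eq)
  then show ?thesis unfolding inj_on_def by blast
qed

lemma lower_part_exists:
  assumes fin: "finite S" and inj: "inj_on (\<lambda>x. u \<bullet> x) S" and j: "j \<le> card S"
  shows "\<exists>L \<subseteq> S. card L = j \<and> below u L (S - L)"
  using j
proof (induction j)
  case 0
  then show ?case by (intro exI[of _ "{}"]) (auto simp: below_def)
next
  case (Suc j)
  then obtain L where L: "L \<subseteq> S" "card L = j" "below u L (S - L)" by auto
  have "finite L" using L(1) fin by (rule finite_subset)
  have "S - L \<noteq> {}" using L(1,2) Suc.prems by auto
  moreover have "finite (S - L)" using fin by simp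
  ultimately obtain x where x: "x \<in> S - L" "\<And>y. y \<in> S - L \<Longrightarrow> u \<bullet> x \<le> u \<bullet> y"
    using that arg_min_if_finite(1)[of "S - L" "\<lambda>x. u \<bullet> x"]
      arg_min_least[of "S - L" _ "\<lambda>x. u \<bullet> x"] by metis
  have "u \<bullet> x < u \<bullet> y" if "y \<in> S - insert x L" for y
  proof -
    have "u \<bullet> x \<noteq> u \<bullet> y" using inj x(1) that unfolding inj_on_def by blast
    then show ?thesis using x(2)[of y] that by force
  qed
  then have "below u (insert x L) (S - insert x L)"
    using L(3) unfolding below_def by blast
  moreover have "card (insert x L) = Suc j"
    using L(2) x(1) \<open>finite L\<close> by simp
  ultimately show ?case using x L(1) by (intro exI[of _ "insert x L"]) auto
qed

section \<open>Triangles\<close>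

lemma triangle_free_subset: "triangle_free S E \<Longrightarrow> E' \<subseteq> E \<Longrightarrow> triangle_free S E'"
  unfolding triangle_free_def by blast

text \<open>
  In a triangle that meets both sides, one vertex is alone on its side, and its two edges would both
  belong to the matching given by \<open>f\<close>.
\<close>

lemma triangle_free_Un_matching:
  assumes A: "triangle_free A E" "E \<subseteq> segments_on A"
    and B: "triangle_free B E'" "E' \<subseteq> segments_on B"
    and disj: "A \<inter> B = {}" and f: "inj_on f A" "f ` A \<subseteq> B"
  shows "triangle_free (A \<union> B) (E \<union> E' \<union> (\<lambda>x. {x, f x}) ` A)"
proof -
  define H where "H = E \<union> E' \<union> (\<lambda>x. {x, f x}) ` A"
  have EA: "e \<subseteq> A" if "e \<in> E" for e using that A(2) segments_on_subset by blast
  have EB: "e \<subseteq> B" if "e \<in> E'" for e using that B(2) segments_on_subset by blast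
  have H: "e \<in> E \<or> e \<in> E' \<or> (\<exists>z\<in>A. e = {z, f z} \<and> f z \<in> B)" if "e \<in> H" for e
    using that f(2) unfolding H_def by blast
  have inA: "{x, y} \<in> E" if "{x, y} \<in> H" "x \<in> A" "y \<in> A" for x y
    using H[OF that(1)]
  proof (elim disjE bexE conjE)
    assume "{x, y} \<in> E'"
    then show ?thesis using EB that(2) disj by blast
  next
    fix z assume "{x, y} = {z, f z}" "f z \<in> B"
    then have "f z \<in> {x, y}" by simp
    with \<open>f z \<in> B\<close> show ?thesis using that(2,3) disj by blast
  qed
  have inB: "{x, y} \<in> E'" if "{x, y} \<in> H" "x \<in> B" "y \<in> B" for x y
    using H[OF that(1)]
  proof (elim disjE bexE conjE)
    assume "{x, y} \<in> E"
    then show ?thesis using EA that(2) disj by blast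
  next
    fix z assume "{x, y} = {z, f z}" "z \<in> A"
    then have "z \<in> {x, y}" by simp
    with \<open>z \<in> A\<close> show ?thesis using that(2,3) disj by blast
  qed
  have across: "y = f x" if "{x, y} \<in> H" "x \<in> A" "y \<in> B" for x y
    using H[OF that(1)]
  proof (elim disjE bexE conjE)
    fix z assume "{x, y} = {z, f z}" "f z \<in> B"
    moreover have "x \<noteq> f z" using \<open>f z \<in> B\<close> that(2) disj by blast
    ultimately show ?thesis by (metis doubleton_eq_iff)
  next
    assume "{x, y} \<in> E"
    then have "y \<in> A" using EA by blast
    then show ?thesis using that(3) disj by blast
  next
    assume "{x, y} \<in> E'"
    then have "x \<in> B" using EB by blast
    then show ?thesis using that(2) disj by blast
  qed
  have apexA: "y = z" if "{x, y} \<in> H" "{x, z} \<in> H" "x \<in> A" "y \<in> B" "z \<in> B" for x y z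
    using across[OF that(1,3,4)] across[OF that(2,3,5)] by simp
  have apexB: "y = z" if "{x, y} \<in> H" "{x, z} \<in> H" "x \<in> B" "y \<in> A" "z \<in> A" for x y z
  proof -
    have "x = f y" "x = f z"
      using across[of y x] across[of z x] that by (simp_all add: insert_commute)
    then show ?thesis using inj_onD[OF f(1) _ that(4,5)] by simp
  qed
  have "triangle_free (A \<union> B) H"
    unfolding triangle_free_def
  proof clarify
    fix a b c
    assume abc: "a \<in> A \<union> B" "b \<in> A \<union> B" "c \<in> A \<union> B" "a \<noteq> b" "b \<noteq> c" "a \<noteq> c"
      and edges: "{a, b} \<in> H" "{b, c} \<in> H" "{a, c} \<in> H"
    have rev: "{b, a} \<in> H" "{c, b} \<in> H" "{c, a} \<in> H"
      using edges by (simp_all only: insert_commute)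
    consider "a \<in> A" "b \<in> A" "c \<in> A" | "a \<in> B" "b \<in> B" "c \<in> B"
      | "a \<in> A" "b \<in> B" "c \<in> B" | "a \<in> B" "b \<in> A" "c \<in> A"
      | "b \<in> A" "a \<in> B" "c \<in> B" | "b \<in> B" "a \<in> A" "c \<in> A"
      | "c \<in> A" "a \<in> B" "b \<in> B" | "c \<in> B" "a \<in> A" "b \<in> A"
      using abc(1-3) by blast
    then show False
    proof cases
      case 1
      then have "{a, b} \<in> E" "{b, c} \<in> E" "{a, c} \<in> E" using inA edges by auto
      then show False using A(1) 1 abc(4-6) unfolding triangle_free_def by blast
    next
      case 2
      then have "{a, b} \<in> E'" "{b, c} \<in> E'" "{a, c} \<in> E'" using inB edges by auto
      then show False using B(1) 2 abc(4-6) unfolding triangle_free_def by blast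
    next
      case 3 then show False using apexA[OF edges(1,3)] abc(5) by blast
    next
      case 4 then show False using apexB[OF edges(1,3)] abc(5) by blast
    next
      case 5 then show False using apexA[OF rev(1) edges(2)] abc(6) by blast
    next
      case 6 then show False using apexB[OF rev(1) edges(2)] abc(6) by blast
    next
      case 7 then show False using apexA[OF rev(3,2)] abc(4) by blast
    next
      case 8 then show False using apexB[OF rev(3,2)] abc(4) by blast
    qed
  qed
  then show ?thesis unfolding H_def .
qed

section \<open>Packing the matchings\<close>

text \<open>
  The set \<open>D\<close> of the two lowest points is also read as the segment between them, which is the
  reserved edge. Letting \<open>u\<close> vary in the induction is what allows the reserved pair to be placed at
  the bottom of the lower part and at the top of the upper part.
\<close>

lemma matching_packing:
  assumes "finite S" "general_position S" "card S = 2 * m" "2 ^ k \<le> m"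
    and "inj_on (\<lambda>x. u \<bullet> x) S"
  shows "\<exists>F D. (\<forall>i<k. perfect_matching S (F i) \<and> non_crossing (F i)) \<and>
           disjoint_family_on F {..<k} \<and>
           D \<subseteq> S \<and> card D = 2 \<and> below u D (S - D) \<and> D \<notin> (\<Union>i<k. F i) \<and>
           triangle_free S (insert D (\<Union>i<k. F i))"
  using assms
proof (induction k arbitrary: S m u)
  case 0
  then obtain D where D: "D \<subseteq> S" "card D = 2" "below u D (S - D)"
    using lower_part_exists[of S u 2] by auto
  have "triangle_free S {D}"
    unfolding triangle_free_def by (auto simp: doubleton_eq_iff)
  then show ?case using D by (auto simp: disjoint_family_on_def)
next
  case (Suc k)
  define a where "a = m div 2"
  define b where "b = m - a"
  have ab: "2 ^ k \<le> a" "2 ^ k \<le> b" "b = a \<or> b = a + 1" "m = a + b"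
    using Suc.prems(4) unfolding a_def b_def by auto
  obtain L where L: "L \<subseteq> S" "card L = 2 * a" "below u L (S - L)"
    using lower_part_exists[OF Suc.prems(1,5), of "2 * a"] Suc.prems(3) ab(4) by auto
  define R where "R = S - L"
  have S: "S = L \<union> R" "L \<inter> R = {}" and LR: "below u L R"
    using L unfolding R_def by auto
  have fin: "finite L" "finite R" using Suc.prems(1) S by auto
  have cardR: "card R = 2 * b"
    using card_Un_disjoint[OF fin S(2)] Suc.prems(3) L(2) ab(4) S(1) by simp
  have gp: "general_position L" "general_position R"
    using Suc.prems(2) unfolding S(1) general_position_def by blast+
  have inj: "inj_on (\<lambda>x. u \<bullet> x) L" "inj_on (\<lambda>x. (- u) \<bullet> x) R"
    using Suc.prems(5) unfolding S(1) inj_on_def by auto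
  obtain F D where F: "\<And>i. i < k \<Longrightarrow> perfect_matching L (F i)"
      "\<And>i. i < k \<Longrightarrow> non_crossing (F i)" "disjoint_family_on F {..<k}"
    and D: "D \<subseteq> L" "card D = 2" "below u D (L - D)" "D \<notin> (\<Union>i<k. F i)"
      "triangle_free L (insert D (\<Union>i<k. F i))"
    using Suc.IH[OF fin(1) gp(1) L(2) ab(1) inj(1)] by blast
  obtain G T where G: "\<And>i. i < k \<Longrightarrow> perfect_matching R (G i)"
      "\<And>i. i < k \<Longrightarrow> non_crossing (G i)" "disjoint_family_on G {..<k}"
    and T: "T \<subseteq> R" "card T = 2" "below (- u) T (R - T)" "T \<notin> (\<Union>i<k. G i)"
      "triangle_free R (insert T (\<Union>i<k. G i))"
    using Suc.IH[OF fin(2) gp(2) cardR ab(2) inj(2)] by blast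
  \<comment> \<open>In the odd case the new matching contains the segment \<open>T\<close> between the two highest points, and
    the points of \<open>L\<close> are joined to the remaining ones of \<open>R\<close>. In the even case all points of \<open>R\<close>
    are joined to \<open>L\<close>.\<close>
  define T' where "T' = (if b = a then {} else T)"
  define M' where "M' = (if b = a then {} else {T})"
  have T': "T' \<subseteq> R" "below u (L \<union> (R - T')) T'" "card (R - T') = card L"
  proof -
    show T'R: "T' \<subseteq> R" using T(1) unfolding T'_def by simp
    show "below u (L \<union> (R - T')) T'"
      using LR T(1,3) unfolding T'_def below_def by auto
    show "card (R - T') = card L"
      using T(2) ab(3) cardR L(2) card_Diff_subset[of T' R] T'R finite_subset[OF T'R fin(2)]
      unfolding T'_def by auto
  qed
  have M': "perfect_matching T' M'" "non_crossing M'" "M' \<subseteq> {T}"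
    using perfect_matching_single[OF T(2)]
    unfolding T'_def M'_def by (auto simp: perfect_matching_def non_crossing_def)
  obtain f where f: "bij_betw f L (R - T')" and ncf: "non_crossing ((\<lambda>x. {x, f x}) ` L)"
  proof -
    have "general_position (L \<union> (R - T'))"
      using Suc.prems(2) unfolding S(1) general_position_def by blast
    then show thesis
      using non_crossing_bij_exists[of L "R - T'"] fin T'(3) S(2) that by auto
  qed
  define M where "M = (\<lambda>x. {x, f x}) ` L"
  have M: "perfect_matching (L \<union> (R - T')) M"
    unfolding M_def using perfect_matching_bij[OF f] S(2) by blast
  have M_across: "e \<inter> L \<noteq> {} \<and> e \<inter> R \<noteq> {}" if "e \<in> M" for e
    using that bij_betwE[OF f] unfolding M_def by auto
  have "perfect_matching (L \<union> (R - T') \<union> T') (M \<union> M')"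
    by (rule perfect_matching_Un[OF M M'(1) below_disjoint[OF T'(2)]])
  then have top1: "perfect_matching S (M \<union> M')"
    using T'(1) S(1) by (metis Un_Diff_cancel2 Un_absorb2 Un_assoc)
  have top2: "non_crossing (M \<union> M')"
    using non_crossing_Un[OF ncf[folded M_def] M'(2) T'(2)] M M'(1)
    unfolding perfect_matching_def by blast
  define H where "H i = (if i = k then M \<union> M' else F i \<union> G i)" for i
  have Hk: "H k = M \<union> M'" and H: "\<And>i. i < k \<Longrightarrow> H i = F i \<union> G i"
    unfolding H_def by auto
  have FL: "\<And>e i. i < k \<Longrightarrow> e \<in> F i \<Longrightarrow> e \<in> segments_on L"
    and GR: "\<And>e i. i < k \<Longrightarrow> e \<in> G i \<Longrightarrow> e \<in> segments_on R"
    using F(1) G(1) perfect_matching_segments by blast+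
  have DL: "D \<in> segments_on L" and TR: "T \<in> segments_on R"
    using D T card_2_segment by blast+
  have M_L: "e \<notin> segments_on L" and M_R: "e \<notin> segments_on R" if "e \<in> M" for e
    using M_across[OF that] segments_on_subset S(2) by blast+
  have UH: "(\<Union>i<Suc k. H i) = (\<Union>i<k. F i) \<union> (\<Union>i<k. G i) \<union> (M \<union> M')"
    using Hk H by (auto simp: lessThan_Suc)
  have "perfect_matching S (H i) \<and> non_crossing (H i)" if "i < Suc k" for i
  proof (cases "i = k")
    case True
    then show ?thesis using top1 top2 Hk by simp
  next
    case False
    then have i: "i < k" using that by simp
    then have "non_crossing (F i \<union> G i)"
      using non_crossing_Un[OF F(2) G(2) LR] FL GR by blast
    then show ?thesis
      unfolding H[OF i] using perfect_matching_Un[OF F(1)[OF i] G(1)[OF i] S(2)] S(1) by simp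
  qed
  moreover have "disjoint_family_on H {..<Suc k}"
  proof -
    have low: "H i \<inter> H j = {}" if "i < k" "j < k" "i \<noteq> j" for i j
    proof -
      have "F i \<inter> F j = {}" "G i \<inter> G j = {}"
        using F(3) G(3) that unfolding disjoint_family_on_def by auto
      moreover have "F i \<inter> G j = {}" "G i \<inter> F j = {}"
        using FL GR segments_on_disjoint[OF S(2)] that by blast+
      ultimately show ?thesis using that H by auto
    qed
    have new: "H i \<inter> H k = {}" if "i < k" for i
    proof -
      have "T \<notin> F i" "T \<notin> G i"
        using FL TR segments_on_disjoint[OF S(2)] T(4) that by blast+
      moreover have "e \<notin> F i" "e \<notin> G i" if "e \<in> M" for e
        using M_L[OF that] M_R[OF that] FL GR \<open>i < k\<close> by blast+
      ultimately show ?thesis using M'(3) unfolding Hk H[OF that] by blast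
    qed
    show ?thesis
      unfolding disjoint_family_on_def
    proof (intro ballI impI)
      fix i j assume "i \<in> {..<Suc k}" "j \<in> {..<Suc k}" "i \<noteq> j"
      then consider "i < k" "j < k" | "i < k" "j = k" | "j < k" "i = k" by fastforce
      then show "H i \<inter> H j = {}"
        using low new \<open>i \<noteq> j\<close> by cases blast+
    qed
  qed
  moreover have "D \<subseteq> S" using D(1) S(1) by blast
  moreover have "below u D (S - D)"
    using D(1,3) LR unfolding S(1) below_def by blast
  moreover have "D \<notin> (\<Union>i<Suc k. H i)"
  proof -
    have "D \<notin> segments_on R" using segments_on_disjoint[OF S(2) DL] .
    then have "D \<notin> (\<Union>i<k. G i)" "D \<notin> M'" using GR TR M'(3) by blast+
    then show ?thesis unfolding UH using D(4) DL M_L by blast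
  qed
  moreover have "triangle_free S (insert D (\<Union>i<Suc k. H i))"
  proof -
    \<comment> \<open>Inside the parts, both reserved segments are admitted as edges: \<open>T\<close> because the new matching
      may contain it, \<open>D\<close> because it stays reserved.\<close>
    have "triangle_free (L \<union> R)
        (insert D (\<Union>i<k. F i) \<union> insert T (\<Union>i<k. G i) \<union> (\<lambda>x. {x, f x}) ` L)"
    proof (rule triangle_free_Un_matching[OF D(5) _ T(5) _ S(2)])
      show "insert D (\<Union>i<k. F i) \<subseteq> segments_on L" using DL FL by blast
      show "insert T (\<Union>i<k. G i) \<subseteq> segments_on R" using TR GR by blast
      show "inj_on f L" "f ` L \<subseteq> R" using f unfolding bij_betw_def by auto
    qed
    then show ?thesis
      unfolding S(1)[symmetric] M_def[symmetric]
      by (rule triangle_free_subset) (use UH M'(3) in auto)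
  qed
  ultimately show ?case using D(2) by (intro exI[of _ H] exI[of _ D]) simp
qed

theorem theorem5:
  fixes S :: "point set" and n k h :: nat
  assumes "finite S" and "card S = 2 * n" and "general_position S"
    and "n = 2 ^ k + h" and "0 \<le> h" and "h < 2 ^ k"
  shows "\<exists>F :: nat \<Rightarrow> point set set.
           (\<forall>i\<in>{1..k}. perfect_matching S (F i) \<and> non_crossing (F i)) \<and>
           disjoint_family_on F {1..k} \<and>
           geometric_graph S (\<Union>i\<in>{1..k}. F i) \<and>
           triangle_free S (\<Union>i\<in>{1..k}. F i)"
proof -
  obtain u where "inj_on (\<lambda>x. u \<bullet> x) S"
    using injective_direction_exists[OF assms(1)] by blast
  then obtain F D where F: "\<And>i. i < k \<Longrightarrow> perfect_matching S (F i) \<and> non_crossing (F i)"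
      "disjoint_family_on F {..<k}" "triangle_free S (insert D (\<Union>i<k. F i))"
    using matching_packing[OF assms(1,3,2), of k u] assms(4) by auto
  define F' where "F' i = F (i - 1)" for i
  have M: "perfect_matching S (F' i) \<and> non_crossing (F' i)" if "i \<in> {1..k}" for i
    unfolding F'_def using F(1) that by auto
  moreover have "disjoint_family_on F' {1..k}"
    unfolding disjoint_family_on_def F'_def
  proof (intro ballI impI)
    fix i j assume "i \<in> {1..k}" "j \<in> {1..k}" "i \<noteq> j"
    then have "i - 1 \<in> {..<k}" "j - 1 \<in> {..<k}" "i - 1 \<noteq> j - 1" by auto
    then show "F (i - 1) \<inter> F (j - 1) = {}"
      using F(2) unfolding disjoint_family_on_def by blast
  qed
  moreover have "geometric_graph S (\<Union>i\<in>{1..k}. F' i)"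
    unfolding geometric_graph_def using assms(3) M perfect_matching_segments by blast
  moreover have "triangle_free S (\<Union>i\<in>{1..k}. F' i)"
    by (rule triangle_free_subset[OF F(3)]) (force simp: F'_def)
  ultimately show ?thesis by (intro exI[of _ F']) simp
qed

end
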